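(* Let $y_+(c,x)$ and $y_-(c',x)$ be the one-parameter solutions of the fifth Painlevé equation described in the context. (1) Suppose that $\theta_x(\theta_0-\theta_x-\theta_\infty)\neq0$, and let $\sigma_0=-2\theta_x-\theta_\infty$. If $c\neq0$ is sufficiently small, then $y_+(c,x)$ has a sequence of zeros $\{x_m^{+(0)}\}$, $m\ge m_0$, such that $$x_m^{+(0)}=2m\pi i-(\sigma_0+1)\log(2m\pi i)-\log\big(-2c/(\theta_0-\theta_x-\theta_\infty)\big)+O(m^{-1}\log m),$$ where $m_0$ is some large positive integer. (2) Suppose that $\theta_0(\theta_x-\theta_0-\theta_\infty)\neq0$, and let $\sigma'_0=2\theta_0+\theta_\infty$. If $c'\neq0$ is sufficiently small, then $y_-(c',x)$ has a sequence of poles $\{x_m^{-(\infty)}\}$, $m\ge m_0$, such that $$x_m^{-(\infty)}=2m\pi i-(\sigma'_0-1)\log(2m\pi i)+\log\big(2c'/(\theta_x-\theta_0-\theta_\infty)\big)+O(m^{-1}\log m),$$ where $m_0$ is some large positive integer.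
   Context: $\theta_0,\theta_x,\theta_\infty\in\mathbb C$ are fixed and $0<\delta<\pi/2$. The fifth Painlevé equation is $$\frac{d^2y}{dx^2}=\Big(\frac1{2y}+\frac1{y-1}\Big)\Big(\frac{dy}{dx}\Big)^2-\frac1x\frac{dy}{dx}+\frac{(y-1)^2}{8x^2}\Big((\theta_0-\theta_x+\theta_\infty)^2y-\frac{(\theta_0-\theta_x-\theta_\infty)^2}y\Big)+(1-\theta_0-\theta_x)\frac yx-\frac{y(y+1)}{2(y-1)}.$$ Let $\tilde B\subset\mathbb C$ be a bounded domain (containing the parameters considered, in particular all sufficiently small ones). Powers are taken on the universal covering of $\mathbb C\setminus\{0\}$. $y_+(c,x)$, $c\in\tilde B$ (when $\theta_x(\theta_0-\theta_x-\theta_\infty)\ne0$), is the family of solutions, holomorphic in $(c,x)$ for $-(\pi/2-\delta)<\arg x-\pi/2<\pi-\delta$, $|e^xx^{\sigma_0-1}|<\varepsilon'$, $|x|>x'_\infty$ (for some small $\varepsilon'$ and large $x'_\infty$ depending on $\tilde B,\delta$), given by the convergent series $$y_+(c,x)=\tfrac12(\theta_0-\theta_x-\theta_\infty)x^{-1}(1+[x^{-1}]_* )+c(1+[x^{-1}]_* )e^xx^{\sigma_0}\Big(1+\sum_{n\ge1}(\tilde a_n+[x^{-1}]_* )(e^xx^{\sigma_0-1})^n\Big),$$ $\tilde a_n\in\mathbb Q_1:=\mathbb Q[\theta_0,\theta_x,\theta_\infty,c,(\theta_0-\theta_x-\theta_\infty)^{-1},\theta_x^{-1}]$. $y_-(c',x)$,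 $c'\in\tilde B$ (when $\theta_0(\theta_0-\theta_x+\theta_\infty)\ne0$), is the family of solutions whose reciprocals are given, for $-(\pi-\delta)<\arg x-\pi/2<\pi/2-\delta$, $|e^{-x}x^{-\sigma'_0-1}|<\varepsilon''$, $|x|>x''_\infty$ (for some small $\varepsilon''$ and large $x''_\infty$ depending on $\tilde B,\delta$), by the convergent series $$1/y_-(c',x)=\tfrac12(\theta_0-\theta_x+\theta_\infty)x^{-1}(1+[x^{-1}]_* )+c'(1+[x^{-1}]_* )e^{-x}x^{-\sigma'_0}\Big(1+\sum_{n\ge1}(\tilde b_n+[x^{-1}]_* )(e^{-x}x^{-\sigma'_0-1})^n\Big),$$ $\tilde b_n\in\mathbb Q_2:=\mathbb Q[\theta_0,\theta_x,\theta_\infty,c',(\theta_0-\theta_x+\theta_\infty)^{-1},\theta_0^{-1}]$. Here $[x^{-1}]_*$ denotes a holomorphic function (possibly different at each occurrence) admitting an asymptotic representation $x^{-1}\sum_{j\ge0}f_jx^{-j}$ as $x\to\infty$ through the respective sector, with coefficients in $\mathbb Q_1$ (resp. $\mathbb Q_2$). *)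

theory Defs
  imports "HOL-Complex_Analysis.Complex_Analysis" "HOL-Library.Landau_Symbols"
begin

text \<open>
  The sectors \<open>-(\<pi>/2-\<delta>) < arg x - \<pi>/2 < \<pi>-\<delta>\<close> and \<open>-(\<pi>-\<delta>) < arg x - \<pi>/2 < \<pi>/2-\<delta>\<close> on the
  universal covering of \<open>\<complex> - {0}\<close> both lie in \<open>\<bar>arg x - \<pi>/2\<bar> < \<pi>\<close>, which projects injectively
  to \<open>\<complex>\<close>.  Hence functions of a plane complex variable suffice, with the branch of the logarithm
  that is cut along the negative imaginary axis (\<open>-\<pi>/2 < arg x \<le> 3\<pi>/2\<close>).
\<close>

definition clog :: "complex \<Rightarrow> complex" where
  "clog x = Ln (x / \<i>) + \<i> * of_real (pi / 2)"

definition carg :: "complex \<Rightarrow> real" where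
  "carg x = Im (clog x)"

definition cpow :: "complex \<Rightarrow> complex \<Rightarrow> complex" where
  "cpow x s = exp (s * clog x)"

lemma exp_clog: "x \<noteq> 0 \<Longrightarrow> exp (clog x) = x"
proof -
  assume "x \<noteq> 0"
  then have "exp (Ln (x / \<i>)) = x / \<i>"
    by (intro exp_Ln) simp
  then show ?thesis
    by (simp only: clog_def exp_add cis_conv_exp[symmetric] cis_pi_half) (simp add: complex_eq_iff)
qed

definition sector :: "real \<Rightarrow> real \<Rightarrow> real \<Rightarrow> complex set" where
  "sector \<alpha> \<beta> R = {x. cmod x > R \<and> \<alpha> < carg x - pi / 2 \<and> carg x - pi / 2 < \<beta>}"

definition painleve5_at ::
  "complex \<Rightarrow> complex \<Rightarrow> complex \<Rightarrow> (complex \<Rightarrow> complex) \<Rightarrow> complex \<Rightarrow> bool" where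
  "painleve5_at \<theta>0 \<theta>x \<theta>inf f x \<longleftrightarrow>
     (let y = f x; y' = deriv f x; y'' = deriv (deriv f) x in
      y'' = (1 / (2 * y) + 1 / (y - 1)) * y'^2 - (1 / x) * y'
            + (y - 1)^2 / (8 * x^2)
                * ((\<theta>0 - \<theta>x + \<theta>inf)^2 * y - (\<theta>0 - \<theta>x - \<theta>inf)^2 / y)
            + (1 - \<theta>0 - \<theta>x) * y / x - y * (y + 1) / (2 * (y - 1)))"

text \<open>
  The right-hand side is singular at \<open>y = 0, 1, \<infinity>\<close>, so a meromorphic function is a solution if it
  satisfies the equation off a set of isolated points.  That \<open>y\<close> avoids 0 and 1 off such a set
  excludes the constants 0 and 1, for which the equation is meaningless.
\<close>

definition painleve5_solution ::
  "complex \<Rightarrow> complex \<Rightarrow> complex \<Rightarrow> complex set \<Rightarrow> (complex \<Rightarrow> complex) \<Rightarrow> bool" where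
  "painleve5_solution \<theta>0 \<theta>x \<theta>inf D f \<longleftrightarrow>
     f meromorphic_on D \<and>
     (\<forall>\<^sub>\<approx>x\<in>D. f x \<noteq> 0 \<and> f x \<noteq> 1 \<and> painleve5_at \<theta>0 \<theta>x \<theta>inf f x)"

definition holomorphic2_on :: "(complex \<times> complex \<Rightarrow> complex) \<Rightarrow> (complex \<times> complex) set \<Rightarrow> bool" where
  "holomorphic2_on f S \<longleftrightarrow>
     (\<forall>p\<in>S. \<exists>a b. (f has_derivative (\<lambda>(h, k). a * h + b * k)) (at p))"

text \<open>
  The ring \<open>\<rat>[G]\<close> generated over \<open>\<rat>\<close> by a set \<open>G\<close> of functions of the parameter \<open>c\<close>; the generators
  used below are constants (in the \<open>\<theta>\<close>'s) and the identity \<open>\<lambda>c. c\<close>.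
\<close>

inductive_set rat_algebra :: "(complex \<Rightarrow> complex) set \<Rightarrow> (complex \<Rightarrow> complex) set"
  for G :: "(complex \<Rightarrow> complex) set" where
  rat: "(\<lambda>_. of_rat r) \<in> rat_algebra G"
| gen: "g \<in> G \<Longrightarrow> g \<in> rat_algebra G"
| add: "f \<in> rat_algebra G \<Longrightarrow> g \<in> rat_algebra G \<Longrightarrow> (\<lambda>c. f c + g c) \<in> rat_algebra G"
| mult: "f \<in> rat_algebra G \<Longrightarrow> g \<in> rat_algebra G \<Longrightarrow> (\<lambda>c. f c * g c) \<in> rat_algebra G"

definition Q1 :: "complex \<Rightarrow> complex \<Rightarrow> complex \<Rightarrow> (complex \<Rightarrow> complex) set" where
  "Q1 \<theta>0 \<theta>x \<theta>inf = rat_algebra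
     {\<lambda>_. \<theta>0, \<lambda>_. \<theta>x, \<lambda>_. \<theta>inf, \<lambda>c. c, \<lambda>_. inverse (\<theta>0 - \<theta>x - \<theta>inf), \<lambda>_. inverse \<theta>x}"

definition Q2 :: "complex \<Rightarrow> complex \<Rightarrow> complex \<Rightarrow> (complex \<Rightarrow> complex) set" where
  "Q2 \<theta>0 \<theta>x \<theta>inf = rat_algebra
     {\<lambda>_. \<theta>0, \<lambda>_. \<theta>x, \<lambda>_. \<theta>inf, \<lambda>c. c, \<lambda>_. inverse (\<theta>0 - \<theta>x + \<theta>inf), \<lambda>_. inverse \<theta>0}"

text \<open>
  \<open>inv_asymp Q B S g\<close>: \<open>g(c,x)\<close> is one of the functions denoted \<open>[x\<^sup>-\<^sup>1]\<^sub>*\<close>, i.e. holomorphic for \<open>x\<close> in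
  the sector \<open>S\<close>, with \<open>g(c,x) \<sim> x\<^sup>-\<^sup>1 \<Sum>\<^sub>j f\<^sub>j(c) x\<^sup>-\<^sup>j\<close> as \<open>x \<rightarrow> \<infinity>\<close> through \<open>S\<close>, and \<open>f\<^sub>j \<in> Q\<close>.
\<close>

definition inv_asymp ::
  "(complex \<Rightarrow> complex) set \<Rightarrow> complex set \<Rightarrow> complex set \<Rightarrow> (complex \<Rightarrow> complex \<Rightarrow> complex) \<Rightarrow> bool" where
  "inv_asymp Q B S g \<longleftrightarrow>
     (\<forall>c\<in>B. g c holomorphic_on S) \<and>
     (\<exists>f. (\<forall>j. f j \<in> Q) \<and>
        (\<forall>c\<in>B. \<forall>N. (\<lambda>x. g c x - (1 / x) * (\<Sum>j<N. f j c * (1 / x)^j))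
                     \<in> O[inf at_infinity (principal S)](\<lambda>x. (1 / x)^(N + 1))))"

text \<open>
  The domain \<open>\<bar>e\<^sup>\<eta>\<^sup>x x\<^sup>s\<^sup>-\<^sup>1\<bar> < \<epsilon>\<close>, \<open>x \<in> S\<close>, where \<open>(\<eta>, s) = (1, \<sigma>\<^sub>0)\<close> for \<open>y\<^sub>+\<close> and \<open>(\<eta>, s) = (-1, -\<sigma>\<^sub>0')\<close> for
  \<open>1/y\<^sub>-\<close>.
\<close>

definition small_exp_domain :: "complex set \<Rightarrow> real \<Rightarrow> complex \<Rightarrow> complex \<Rightarrow> complex set" where
  "small_exp_domain S \<epsilon> \<eta> s = {x\<in>S. cmod (exp (\<eta> * x) * cpow x (s - 1)) < \<epsilon>}"

text \<open>
  \<open>h(c,x) = \<kappa>x\<^sup>-\<^sup>1(1+[x\<^sup>-\<^sup>1]\<^sub>*) + c(1+[x\<^sup>-\<^sup>1]\<^sub>*) e\<^sup>\<eta>\<^sup>x x\<^sup>s (1 + \<Sum>\<^sub>n\<^sub>\<ge>\<^sub>1 (a\<^sub>n+[x\<^sup>-\<^sup>1]\<^sub>*) w\<^sup>n)\<close> at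
  \<open>w = e\<^sup>\<eta>\<^sup>x x\<^sup>s\<^sup>-\<^sup>1\<close>.  Convergence is that of a power series in \<open>w\<close> whose coefficients are functions on
  the sector: for each \<open>c\<close> and \<open>r < \<epsilon>\<close>, uniformly in \<open>x \<in> S\<close> and \<open>\<bar>w\<bar> \<le> r\<close>.
\<close>

definition has_exp_expansion ::
  "(complex \<Rightarrow> complex) set \<Rightarrow> complex set \<Rightarrow> complex set \<Rightarrow> real \<Rightarrow> complex \<Rightarrow> complex \<Rightarrow> complex \<Rightarrow>
   (complex \<Rightarrow> complex \<Rightarrow> complex) \<Rightarrow> bool" where
  "has_exp_expansion Q B S \<epsilon> \<kappa> \<eta> s h \<longleftrightarrow>
     (\<exists>g0 g1 a g. inv_asymp Q B S g0 \<and> inv_asymp Q B S g1 \<and>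
        (\<forall>n\<ge>1. a n \<in> Q \<and> inv_asymp Q B S (g n)) \<and>
        (\<forall>c\<in>B. \<forall>r<\<epsilon>. uniformly_convergent_on (S \<times> cball 0 r)
            (\<lambda>N (x, w). \<Sum>n=1..N. (a n c + g n c x) * w^n)) \<and>
        (\<forall>c\<in>B. \<forall>x\<in>small_exp_domain S \<epsilon> \<eta> s.
            h c x = \<kappa> * (1 / x) * (1 + g0 c x)
              + c * (1 + g1 c x) * exp (\<eta> * x) * cpow x s
                * (1 + (\<Sum>n. (a (Suc n) c + g (Suc n) c x)
                               * (exp (\<eta> * x) * cpow x (s - 1))^(Suc n)))))"

abbreviation sector_plus :: "real \<Rightarrow> real \<Rightarrow> complex set" where
  "sector_plus \<delta> R \<equiv> sector (- (pi / 2 - \<delta>)) (pi - \<delta>) R"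

abbreviation sector_minus :: "real \<Rightarrow> real \<Rightarrow> complex set" where
  "sector_minus \<delta> R \<equiv> sector (- (pi - \<delta>)) (pi / 2 - \<delta>) R"

definition dom_plus :: "real \<Rightarrow> real \<Rightarrow> real \<Rightarrow> complex \<Rightarrow> complex set" where
  "dom_plus \<delta> \<epsilon> R \<sigma> = small_exp_domain (sector_plus \<delta> R) \<epsilon> 1 \<sigma>"

definition dom_minus :: "real \<Rightarrow> real \<Rightarrow> real \<Rightarrow> complex \<Rightarrow> complex set" where
  "dom_minus \<delta> \<epsilon> R \<sigma>' = small_exp_domain (sector_minus \<delta> R) \<epsilon> (-1) (- \<sigma>')"

definition y_plus_family ::
  "complex \<Rightarrow> complex \<Rightarrow> complex \<Rightarrow> complex \<Rightarrow> real \<Rightarrow> complex set \<Rightarrow> real \<Rightarrow> real \<Rightarrow>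
   (complex \<Rightarrow> complex \<Rightarrow> complex) \<Rightarrow> bool" where
  "y_plus_family \<theta>0 \<theta>x \<theta>inf \<sigma> \<delta> B \<epsilon> R y \<longleftrightarrow>
     \<epsilon> > 0 \<and> R > 0 \<and>
     holomorphic2_on (\<lambda>(c, x). y c x) (B \<times> dom_plus \<delta> \<epsilon> R \<sigma>) \<and>
     (\<forall>c\<in>B. painleve5_solution \<theta>0 \<theta>x \<theta>inf (dom_plus \<delta> \<epsilon> R \<sigma>) (y c)) \<and>
     has_exp_expansion (Q1 \<theta>0 \<theta>x \<theta>inf) B (sector_plus \<delta> R) \<epsilon>
       ((\<theta>0 - \<theta>x - \<theta>inf) / 2) 1 \<sigma> y"

text \<open>
  \<open>u\<close> is the reciprocal of \<open>y\<^sub>-\<close>; at a pole of \<open>y\<^sub>-\<close> the value of the HOL function \<open>y c\<close> is irrelevant.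
\<close>

definition y_minus_family ::
  "complex \<Rightarrow> complex \<Rightarrow> complex \<Rightarrow> complex \<Rightarrow> real \<Rightarrow> complex set \<Rightarrow> real \<Rightarrow> real \<Rightarrow>
   (complex \<Rightarrow> complex \<Rightarrow> complex) \<Rightarrow> bool" where
  "y_minus_family \<theta>0 \<theta>x \<theta>inf \<sigma>' \<delta> B \<epsilon> R y \<longleftrightarrow>
     \<epsilon> > 0 \<and> R > 0 \<and>
     (\<forall>c\<in>B. painleve5_solution \<theta>0 \<theta>x \<theta>inf (dom_minus \<delta> \<epsilon> R \<sigma>') (y c)) \<and>
     (\<exists>u. has_exp_expansion (Q2 \<theta>0 \<theta>x \<theta>inf) B (sector_minus \<delta> R) \<epsilon>
            ((\<theta>0 - \<theta>x + \<theta>inf) / 2) (-1) (- \<sigma>') u \<and>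
          (\<forall>c\<in>B. \<forall>x\<in>dom_minus \<delta> \<epsilon> R \<sigma>'. \<not> is_pole (y c) x \<longrightarrow> 1 / y c x = u c x))"

end

theory Submission
  imports Defs "HOL-Real_Asymp.Real_Asymp"
begin

text \<open>
  Divide the expansion \<open>h = \<kappa>x\<^sup>-\<^sup>1(1+g\<^sub>0) + c(1+g\<^sub>1)e\<^sup>\<eta>\<^sup>xx\<^sup>s(1+P)\<close> by \<open>\<kappa>x\<^sup>-\<^sup>1(1+g\<^sub>0)\<close> and take logarithms: \<open>h = 0\<close>
  becomes \<open>\<eta>x + (s+1) log x + L + E(x) = 2m\<pi>i\<eta>\<close> with \<open>e\<^sup>L = -c/\<kappa>\<close> and
  \<open>E = log(1+g\<^sub>1) + log(1+P) - log(1+g\<^sub>0)\<close>.  Solved for the leading term \<open>x\<close>, this is a fixed point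
  equation.  On the unit disc about the first approximation \<open>2m\<pi>i - \<eta>((s+1) log(2m\<pi>i) + L)\<close> the
  quantity \<open>w = e\<^sup>\<eta>\<^sup>xx\<^sup>s\<^sup>-\<^sup>1\<close> is \<open>O(m\<^sup>-\<^sup>2)\<close>, so \<open>E = O(m\<^sup>-\<^sup>1)\<close> and the map moves the disc into a disc of radius
  \<open>O(m\<^sup>-\<^sup>1 log m)\<close>; Brouwer's theorem gives the zero together with the error term.  For \<open>y\<^sub>-\<close> this
  yields zeros of the reciprocal, near which \<open>y\<^sub>-\<close> tends to infinity.
\<close>

section \<open>Power series in \<open>w\<close> with coefficients depending on
  \<open>x\<close>\<close>

text \<open>Uniform convergence at \<open>w = r\<close> bounds all but finitely many of the numbers
  \<open>norm (b n x) * r ^ n\<close>, uniformly in \<open>x\<close>; the remaining ones are bounded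
  along \<open>F\<close> by \<open>bdd\<close>. Comparison with a geometric series of ratio at most
  1/2 then leaves one factor \<open>norm w\<close>, which later makes the series as small as
  \<open>w\<close> itself.\<close>

lemma power_series_uniform_bound:
  fixes b :: "nat \<Rightarrow> 'a \<Rightarrow> complex"
  assumes uc: "uniformly_convergent_on (S \<times> cball 0 r) (\<lambda>N (x, w). \<Sum>n=1..N. b n x * w ^ n)"
    and r: "r > 0"
    and bdd: "\<And>n. n \<ge> 1 \<Longrightarrow> \<exists>M. \<forall>\<^sub>F x in F. x \<in> S \<longrightarrow> norm (b n x) \<le> M"
  shows "\<exists>M>0. \<forall>\<^sub>F x in F. x \<in> S \<longrightarrow>
           (\<forall>w. norm w \<le> r / 2 \<longrightarrow> norm (\<Sum>n. b (Suc n) x * w ^ Suc n) \<le> M * norm w)"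
proof -
  let ?P = "\<lambda>N (x, w). \<Sum>n=1..N. b n x * w ^ n"
  have "uniformly_Cauchy_on (S \<times> cball 0 r) ?P"
    using uc by (rule uniformly_convergent_Cauchy)
  then have "\<exists>N. \<forall>p\<in>S \<times> cball 0 r. \<forall>m\<ge>N. \<forall>n\<ge>N. dist (?P m p) (?P n p) < 1"
    unfolding uniformly_Cauchy_on_def by (rule allE[of _ 1]) simp
  then obtain N where N: "\<And>p m n. p \<in> S \<times> cball 0 r \<Longrightarrow> m \<ge> N \<Longrightarrow> n \<ge> N \<Longrightarrow> dist (?P m p) (?P n p) < 1"
    by blast
  have tail: "norm (b (Suc n) x) * r ^ Suc n \<le> 1" if "x \<in> S" "n \<ge> N" for x n
  proof -
    \<comment> \<open>Two consecutive partial sums at \<open>w = r\<close> differ by exactly one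
      term, so the Cauchy condition bounds that term.\<close>
    have "dist (?P (Suc n) (x, of_real r)) (?P n (x, of_real r)) < 1"
      using that r by (intro N) auto
    then have "norm (b (Suc n) x * of_real r ^ Suc n) < 1"
      by (simp add: dist_norm)
    then show ?thesis
      using r by (simp add: norm_mult norm_power)
  qed
  have "\<forall>n\<in>{1..}. \<exists>M. \<forall>\<^sub>F x in F. x \<in> S \<longrightarrow> norm (b n x) \<le> M"
    using bdd by simp
  from bchoice[OF this] obtain M where M: "\<And>n. n \<ge> 1 \<Longrightarrow> \<forall>\<^sub>F x in F. x \<in> S \<longrightarrow> norm (b n x) \<le> M n"
    by auto
  \<comment> \<open>The summand 1 covers the indices beyond \<open>N\<close>, the sum covers those
    up to \<open>N\<close>. Absolute values are taken because the bounds \<open>M n\<close> carry no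
    sign information.\<close>
  define K where "K = 1 + (\<Sum>n=1..N. \<bar>M n\<bar> * r ^ n)"
  have K: "K \<ge> 1"
    unfolding K_def using r by (simp add: sum_nonneg)
  have "\<forall>\<^sub>F x in F. \<forall>n\<in>{1..N}. x \<in> S \<longrightarrow> norm (b n x) \<le> M n"
    using M by (intro eventually_ball_finite) auto
  then have "\<forall>\<^sub>F x in F. x \<in> S \<longrightarrow>
           (\<forall>w. norm w \<le> r / 2 \<longrightarrow> norm (\<Sum>n. b (Suc n) x * w ^ Suc n) \<le> (2 * K / r) * norm w)"
  proof eventually_elim
    case (elim x)
    show ?case
    proof (intro impI allI)
      fix w :: complex
      assume x: "x \<in> S" and w: "norm w \<le> r / 2"
      have coeff: "norm (b (Suc n) x) * r ^ Suc n \<le> K" for n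
      proof (cases "n \<ge> N")
        case True
        then show ?thesis
          using tail[OF x] K by (meson order_trans)
      next
        case False
        then have "norm (b (Suc n) x) * r ^ Suc n \<le> \<bar>M (Suc n)\<bar> * r ^ Suc n"
          using elim x r by (intro mult_right_mono order_trans[OF _ abs_ge_self]) auto
        also have "\<dots> \<le> (\<Sum>n=1..N. \<bar>M n\<bar> * r ^ n)"
          using False r by (intro member_le_sum) auto
        finally show ?thesis
          unfolding K_def by simp
      qed
      have term_le: "norm (b (Suc n) x * w ^ Suc n) \<le> K * (norm w / r) * (1 / 2) ^ n" for n
      proof -
        \<comment> \<open>Of the \<open>Suc n\<close> factors \<open>norm w / r\<close> one is kept
          and the other \<open>n\<close> are estimated by 1/2.\<close>
        have "norm (b (Suc n) x * w ^ Suc n) = (norm (b (Suc n) x) * r ^ Suc n) * ((norm w / r) * (norm w / r) ^ n)"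
          using r by (simp add: norm_mult norm_power power_divide)
        also have "\<dots> \<le> K * ((norm w / r) * (1 / 2) ^ n)"
          using r w K coeff[of n] by (intro mult_mono power_mono) (auto simp: field_simps)
        finally show ?thesis
          by (simp add: mult.assoc)
      qed
      have geo: "(\<lambda>n. K * (norm w / r) * (1 / 2) ^ n) sums (K * (norm w / r) * 2)"
        using geometric_sums[of "1 / 2 :: real"] by (intro sums_mult) simp
      have "norm (\<Sum>n. b (Suc n) x * w ^ Suc n) \<le> K * (norm w / r) * 2"
        using norm_suminf_le[OF term_le sums_summable[OF geo]] sums_unique[OF geo] by simp
      then show "norm (\<Sum>n. b (Suc n) x * w ^ Suc n) \<le> (2 * K / r) * norm w"
        by (simp add: mult_ac)
    qed
  qed
  moreover have "2 * K / r > 0"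
    using K r by simp
  ultimately show ?thesis
    by blast
qed

text \<open>Pulling the uniform limit on \<open>S \<times> cball 0 r\<close> back along
  \<open>x \<mapsto> (x, w x)\<close> gives a uniform limit of continuous partial sums on
  \<open>K\<close>, and pointwise this limit is the infinite series.\<close>

lemma power_series_composite_continuous:
  fixes b :: "nat \<Rightarrow> 'a :: topological_space \<Rightarrow> complex"
  assumes uc: "uniformly_convergent_on (S \<times> cball 0 r) (\<lambda>N (x, w). \<Sum>n=1..N. b n x * w ^ n)"
    and "K \<subseteq> S" and w: "continuous_on K w" "\<And>x. x \<in> K \<Longrightarrow> norm (w x) \<le> r"
    and b: "\<And>n. n \<ge> 1 \<Longrightarrow> continuous_on K (b n)"
  shows "continuous_on K (\<lambda>x. \<Sum>n. b (Suc n) x * w x ^ Suc n)"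
proof -
  let ?P = "\<lambda>N (x, w). \<Sum>n=1..N. b n x * w ^ n"
  obtain l where "uniform_limit (S \<times> cball 0 r) ?P l sequentially"
    using uc unfolding uniformly_convergent_on_def by blast
  then have "uniform_limit K (\<lambda>N x. ?P N (x, w x)) (\<lambda>x. l (x, w x)) sequentially"
    by (rule uniform_limit_compose') (use assms in auto)
  then have lim: "uniform_limit K (\<lambda>N x. \<Sum>n<N. b (Suc n) x * w x ^ Suc n) (\<lambda>x. l (x, w x)) sequentially"
    by (simp add: sum.atLeast1_atMost_eq)
  then have "continuous_on K (\<lambda>x. l (x, w x))"
    by (rule uniform_limit_theorem[rotated])
      (auto intro!: always_eventually continuous_intros w b)
  moreover have "l (x, w x) = (\<Sum>n. b (Suc n) x * w x ^ Suc n)" if "x \<in> K" for x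
    using tendsto_uniform_limitI[OF lim that] by (simp add: sums_def sums_unique)
  ultimately show ?thesis
    by (simp cong: continuous_on_cong)
qed

text \<open>Truncation of the asymptotic expansion at \<open>N = 0\<close> leaves an empty sum, and
  the remainder estimate is then the bound O(1/x) for \<open>g\<close> itself.\<close>

lemma inv_asymp_bound:
  assumes "inv_asymp Q B S g" "c \<in> B"
  shows "\<exists>C>0. \<forall>\<^sub>F x in at_infinity. x \<in> S \<longrightarrow> norm (g c x) \<le> C / norm x"
proof -
  obtain f where f: "\<And>N. (\<lambda>x. g c x - (1 / x) * (\<Sum>j<N. f j c * (1 / x) ^ j))
                     \<in> O[inf at_infinity (principal S)](\<lambda>x. (1 / x) ^ (N + 1))"
    using assms unfolding inv_asymp_def by blast
  have "(\<lambda>x. g c x) \<in> O[inf at_infinity (principal S)](\<lambda>x. 1 / x)"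
    using f[of 0] by simp
  then obtain C where "C > 0" "\<forall>\<^sub>F x in inf at_infinity (principal S). norm (g c x) \<le> C * norm (1 / x)"
    by (elim landau_o.bigE)
  then show ?thesis
    by (auto simp: eventually_inf_principal norm_divide)
qed

section \<open>First approximation and its unit disc\<close>

text \<open>This is the root of the logarithmic equation when \<open>E\<close> is dropped and the
  logarithm of \<open>x\<close> is frozen at that of 2m\<pi>i. The factor \<open>\<eta>\<close>
  stands for 1/\<open>\<eta>\<close>, the two being equal for \<open>\<eta>\<close> = 1 and
  \<open>\<eta>\<close> = -1.\<close>

definition log_center :: "complex \<Rightarrow> complex \<Rightarrow> complex \<Rightarrow> nat \<Rightarrow> complex" where
  "log_center \<eta> s L m = 2 * of_nat m * of_real pi * \<i>
     - \<eta> * ((s + 1) * Ln (2 * of_nat m * of_real pi * \<i>) + L)"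

lemma Ln_imaginary_nat:
  assumes "m > 0"
  shows "Ln (2 * of_nat m * of_real pi * \<i>) = of_real (ln (2 * pi * real m)) + \<i> * of_real (pi / 2)"
proof -
  have "2 * of_nat m * of_real pi * \<i> / of_real (2 * pi * real m) = \<i>"
    using assms by simp
  moreover have "Ln (2 * of_nat m * of_real pi * \<i> / of_real (2 * pi * real m))
      = Ln (2 * of_nat m * of_real pi * \<i>) - of_real (ln (2 * pi * real m))"
    using assms by (intro Ln_divide_of_real) auto
  ultimately have "Ln \<i> = Ln (2 * of_nat m * of_real pi * \<i>) - of_real (ln (2 * pi * real m))"
    by (simp only:)
  then show ?thesis
    by (simp add: algebra_simps)
qed

text \<open>The distance from \<open>x\<close> to 2m\<pi>i is at most 1 plus the size of the
  logarithmic correction, hence O(log m), and it is divided by 2\<pi>m.\<close>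

lemma log_center_dist:
  "\<exists>C>0. \<forall>\<^sub>F m in sequentially. \<forall>x\<in>cball (log_center \<eta> s L m) 1.
     norm (x / (2 * of_nat m * of_real pi * \<i>) - 1) \<le> C * (ln (real m) / real m)"
proof -
  \<comment> \<open>\<open>a\<close> is the coefficient of \<open>ln (real m)\<close> in the
    distance and \<open>k\<close> collects the bounded terms. As soon as
    \<open>k \<le> ln (real m)\<close>, these cost one more \<open>ln (real m)\<close>, whence the
    constant \<open>a + 1\<close>.\<close>
  define a where "a = norm \<eta> * norm (s + 1)"
  define k where "k = 1 + a * (\<bar>ln (2 * pi)\<bar> + pi) + norm \<eta> * norm L"
  have "a \<ge> 0"
    by (simp add: a_def)
  have "\<forall>\<^sub>F m::nat in sequentially. k \<le> ln (real m) \<and> m > 0"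
    by (intro eventually_conj eventually_gt_at_top) real_asymp
  then have "\<forall>\<^sub>F m in sequentially. \<forall>x\<in>cball (log_center \<eta> s L m) 1.
     norm (x / (2 * of_nat m * of_real pi * \<i>) - 1) \<le> (a + 1) * (ln (real m) / real m)"
  proof eventually_elim
    case (elim m)
    show ?case
    proof
      fix x
      assume x: "x \<in> cball (log_center \<eta> s L m) 1"
      define z where "z = 2 * of_nat m * of_real pi * \<i>"
      have nz: "norm z = 2 * pi * real m"
        by (simp add: z_def norm_mult)
      have z0: "z \<noteq> 0"
        using elim by (simp add: z_def)
      have "k \<ge> 1"
        using \<open>a \<ge> 0\<close> by (simp add: k_def)
      then have lm: "ln (real m) \<ge> 1"
        using elim by linarith
      have "Ln z = of_real (ln (2 * pi) + ln (real m)) + \<i> * of_real (pi / 2)"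
        using elim Ln_imaginary_nat[of m] by (simp add: z_def ln_mult)
      then have "norm (Ln z) \<le> \<bar>ln (2 * pi) + ln (real m)\<bar> + pi / 2"
        by (metis norm_triangle_ineq norm_of_real norm_mult norm_ii mult_1 abs_of_nonneg pi_half_ge_zero)
      then have Lz: "norm (Ln z) \<le> \<bar>ln (2 * pi)\<bar> + ln (real m) + pi"
        using lm pi_gt_zero by linarith
      have "norm (x - z) \<le> norm (x - log_center \<eta> s L m) + norm (log_center \<eta> s L m - z)"
        by norm
      also have "norm (x - log_center \<eta> s L m) \<le> 1"
        using x by (simp add: dist_norm norm_minus_commute)
      also have "norm (log_center \<eta> s L m - z) = norm \<eta> * norm ((s + 1) * Ln z + L)"
        by (simp add: log_center_def z_def norm_mult)
      also have "\<dots> \<le> norm \<eta> * (norm (s + 1) * (\<bar>ln (2 * pi)\<bar> + ln (real m) + pi) + norm L)"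
        using Lz by (intro mult_left_mono order_trans[OF norm_triangle_ineq] add_mono)
          (auto simp: norm_mult intro!: mult_left_mono)
      also have "1 + \<dots> = k + a * ln (real m)"
        by (simp add: k_def a_def algebra_simps)
      also have "\<dots> \<le> (a + 1) * ln (real m)"
        using elim by (simp add: algebra_simps)
      finally have d: "norm (x - z) \<le> (a + 1) * ln (real m)"
        by simp
      have "norm (x / z - 1) = norm (x - z) / (2 * pi * real m)"
        using z0 unfolding nz[symmetric] norm_divide[symmetric] by (simp add: diff_divide_distrib)
      also have "\<dots> \<le> (a + 1) * ln (real m) / (1 * real m)"
        using d elim lm \<open>a \<ge> 0\<close> pi_gt3 by (intro frac_le mult_right_mono) auto
      finally show "norm (x / (2 * of_nat m * of_real pi * \<i>) - 1) \<le> (a + 1) * (ln (real m) / real m)"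
        by (simp add: z_def)
    qed
  qed
  moreover have "a + 1 > 0"
    using \<open>a \<ge> 0\<close> by simp
  ultimately show ?thesis
    by blast
qed

text \<open>Division by \<open>\<i>\<close> turns the cut of \<open>clog\<close> into that of
  \<open>Ln\<close>, and the remaining division by the positive number 2\<pi>m crosses no cut. The
  identity therefore holds for every nonzero \<open>x\<close>, without a correction by multiples of
  2\<pi>i.\<close>

lemma clog_minus_Ln_imaginary_nat:
  assumes "m > 0" "x \<noteq> 0"
  shows "clog x - Ln (2 * of_nat m * of_real pi * \<i>) = Ln (x / (2 * of_nat m * of_real pi * \<i>))"
proof -
  have "x / \<i> / of_real (2 * pi * real m) = x / (2 * of_nat m * of_real pi * \<i>)"
    by (simp only: divide_divide_eq_left) (simp add: mult_ac)
  moreover have "Ln (x / \<i> / of_real (2 * pi * real m)) = Ln (x / \<i>) - of_real (ln (2 * pi * real m))"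
    using assms by (intro Ln_divide_of_real) auto
  ultimately have "Ln (x / (2 * of_nat m * of_real pi * \<i>)) = Ln (x / \<i>) - of_real (ln (2 * pi * real m))"
    by (simp only:)
  then show ?thesis
    using assms by (simp add: clog_def Ln_imaginary_nat)
qed

lemma exp_imaginary_nat_eq_1:
  assumes "\<eta> = 1 \<or> \<eta> = - 1"
  shows "exp (\<eta> * (2 * of_nat m * of_real pi * \<i>)) = 1"
proof -
  have "exp (2 * of_nat m * of_real pi * \<i>) = exp (2 * of_real pi * \<i>) ^ m"
    by (simp add: exp_of_nat_mult[symmetric] mult_ac)
  then have "exp (2 * of_nat m * of_real pi * \<i>) = 1"
    by simp
  then show ?thesis
    using assms by (auto simp: exp_minus)
qed

text \<open>On the disc the quotient \<open>q\<close> of \<open>x\<close> by 2m\<pi>i tends to 1.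
  Hence the argument of \<open>x\<close> tends to \<pi>/2, an interior direction of the sector, and
  the exponential times the power \<open>s + 1\<close> of \<open>x\<close> stays bounded; the power
  \<open>s - 1\<close> gains two factors 1/x, one of which suffices below.\<close>

lemma log_center_nbhd:
  assumes \<eta>: "\<eta> = 1 \<or> \<eta> = - 1" and \<alpha>: "\<alpha> < 0" "0 < \<beta>"
  shows "\<exists>C>0. \<forall>\<^sub>F m in sequentially. \<forall>x\<in>cball (log_center \<eta> s L m) 1.
     norm (clog x - Ln (2 * of_nat m * of_real pi * \<i>)) \<le> C * (ln (real m) / real m)
     \<and> real m \<le> norm x \<and> x \<in> sector \<alpha> \<beta> R \<and> isCont clog x
     \<and> norm (exp (\<eta> * x) * cpow x (s - 1)) \<le> C / real m"
proof -
  obtain C where C: "C > 0" and ev: "\<forall>\<^sub>F m in sequentially. \<forall>x\<in>cball (log_center \<eta> s L m) 1.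
     norm (x / (2 * of_nat m * of_real pi * \<i>) - 1) \<le> C * (ln (real m) / real m)"
    using log_center_dist by blast
  \<comment> \<open>\<open>2 * C\<close> comes from the estimate of \<open>Ln q\<close> by twice
    \<open>norm (q - 1)\<close>; the exponential bounds the quantity left after cancellation, where
    \<open>d\<close> and \<open>Ln q\<close> have norm at most 1.\<close>
  define D where "D = max (2 * C) (exp (1 + norm (s + 1) + norm L))"
  have \<eta>\<eta>: "\<eta> * \<eta> = 1" "norm \<eta> = 1"
    using \<eta> by auto
  \<comment> \<open>The bound 1/3 keeps \<open>q\<close> where the estimate of \<open>Ln q\<close>
    applies. The other two are chosen so that the deviation of the argument, below
    \<open>2 * e\<close>, stays strictly inside the sector.\<close>
  define e where "e = min (1 / 3) (min (- \<alpha> / 3) (\<beta> / 3))"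
  have e: "e > 0"
    using \<alpha> by (auto simp: e_def)
  have "(\<lambda>m::nat. C * (ln (real m) / real m)) \<longlonglongrightarrow> 0"
    by real_asymp
  then have small: "\<forall>\<^sub>F m::nat in sequentially. C * (ln (real m) / real m) < e"
    using e by (rule order_tendstoD)
  have "\<forall>\<^sub>F m::nat in sequentially. real m \<ge> R + 1"
    by real_asymp
  with ev small have "\<forall>\<^sub>F m in sequentially. \<forall>x\<in>cball (log_center \<eta> s L m) 1.
     norm (clog x - Ln (2 * of_nat m * of_real pi * \<i>)) \<le> D * (ln (real m) / real m)
     \<and> real m \<le> norm x \<and> x \<in> sector \<alpha> \<beta> R \<and> isCont clog x
     \<and> norm (exp (\<eta> * x) * cpow x (s - 1)) \<le> D / real m"
    using eventually_ge_at_top[of 1]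
  proof eventually_elim
    case (elim m)
    show ?case
    proof
      fix x
      assume x: "x \<in> cball (log_center \<eta> s L m) 1"
      define z where "z = 2 * of_nat m * of_real pi * \<i>"
      define t where "t = ln (real m) / real m"
      have z0: "z \<noteq> 0"
        using elim by (simp add: z_def)
      have t0: "t \<ge> 0"
        using elim by (simp add: t_def)
      define q where "q = x / z"
      have q: "norm (q - 1) \<le> C * t" "C * t < e"
        using elim x by (auto simp: q_def z_def t_def)
      then have q13: "norm (q - 1) < 1 / 3"
        by (simp add: e_def)
      then have Req: "Re q > 2 / 3"
        using abs_Re_le_cmod[of "q - 1"] by (simp add: abs_if split: if_splits)
      then have nq: "norm q \<ge> 2 / 3"
        using complex_Re_le_cmod[of q] by linarith
      have xqz: "x = q * z"
        using z0 by (simp add: q_def)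
      have x0: "x \<noteq> 0"
        using xqz z0 Req by auto
      have "norm z = 2 * pi * real m"
        by (simp add: z_def norm_mult)
      moreover have "2 * 3 * real m \<le> 2 * pi * real m"
        using pi_gt3 by (intro mult_right_mono) auto
      ultimately have "norm x \<ge> 2 / 3 * (2 * 3 * real m)"
        unfolding xqz norm_mult using nq by (intro mult_mono) auto
      then have nx: "norm x \<ge> real m"
        by simp
      have lnq: "clog x - Ln z = Ln q"
        using clog_minus_Ln_imaginary_nat[of m x] elim x0 by (simp add: z_def q_def)
      have "norm (Ln (1 + (q - 1))) \<le> 2 * norm (q - 1)"
        using q13 by (intro norm_Ln_le) simp
      then have nlnq: "norm (Ln q) \<le> 2 * norm (q - 1)"
        by simp
      have "Im (clog x) = Im (Ln q) + pi / 2"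
        using lnq Ln_imaginary_nat[of m] elim by (simp add: z_def algebra_simps)
      moreover have "\<bar>Im (Ln q)\<bar> < 2 * e"
        using abs_Im_le_cmod[of "Ln q"] nlnq q by linarith
      moreover have "2 * e < - \<alpha>" "2 * e < \<beta>"
        using \<alpha> by (auto simp: e_def min_def)
      ultimately have sec: "x \<in> sector \<alpha> \<beta> R"
        using nx elim by (auto simp: sector_def carg_def)
      \<comment> \<open>Up to a positive factor \<open>x / \<i>\<close> equals \<open>q\<close>,
        which lies in the right half plane, away from the cut of \<open>clog\<close>.\<close>
      have "x / \<i> = q * of_real (2 * pi * real m)"
        by (simp add: xqz z_def mult_ac)
      then have "Re (x / \<i>) > 0"
        using Req elim by (simp only: Re_complex_of_real Im_complex_of_real times_complex.simps) simp
      then have "x / \<i> \<notin> \<real>\<^sub>\<le>\<^sub>0"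
        by (auto simp: complex_nonpos_Reals_iff)
      then have cont: "isCont clog x"
        unfolding clog_def by (intro continuous_intros) auto
      define d where "d = x - log_center \<eta> s L m"
      have nd: "norm d \<le> 1"
        using x by (simp add: d_def dist_norm norm_minus_commute)
      \<comment> \<open>Inserting the centre cancels the unbounded term
        \<open>(s + 1) * Ln z\<close>, because \<open>\<eta> * \<eta> = 1\<close>. What remains
        besides \<open>\<eta> * z\<close>, whose exponential is 1, is bounded.\<close>
      have "\<eta> * x + (s + 1) * clog x = \<eta> * z + (\<eta> * d + (s + 1) * Ln q - L)"
      proof -
        have "x = d + z - \<eta> * ((s + 1) * Ln z + L)"
          by (simp add: d_def log_center_def z_def)
        then have "\<eta> * x = \<eta> * d + \<eta> * z - (\<eta> * \<eta>) * ((s + 1) * Ln z + L)"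
          by (simp only: right_diff_distrib distrib_left mult.assoc)
        then show ?thesis
          unfolding \<eta>\<eta> lnq[symmetric] by (simp add: algebra_simps)
      qed
      then have "exp (\<eta> * x + (s + 1) * clog x) = exp (\<eta> * d + (s + 1) * Ln q - L)"
        using exp_imaginary_nat_eq_1[OF \<eta>, of m] by (simp add: exp_add z_def)
      moreover have "exp (\<eta> * x) * cpow x (s - 1) = exp (\<eta> * x + (s + 1) * clog x) / x ^ 2"
      proof -
        have "exp (\<eta> * x + (s + 1) * clog x) = exp (\<eta> * x) * exp ((s - 1) * clog x) * (exp (clog x) * exp (clog x))"
          by (simp add: algebra_simps flip: exp_add)
        then show ?thesis
          using x0 by (simp add: cpow_def exp_clog power2_eq_square)
      qed
      ultimately have "norm (exp (\<eta> * x) * cpow x (s - 1)) = norm (exp (\<eta> * d + (s + 1) * Ln q - L)) / norm x ^ 2"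
        by (simp add: norm_divide norm_power)
      also have "norm (exp (\<eta> * d + (s + 1) * Ln q - L)) \<le> exp (norm (\<eta> * d + (s + 1) * Ln q - L))"
        by (rule norm_exp)
      also have "norm (\<eta> * d + (s + 1) * Ln q - L) \<le> norm (\<eta> * d) + norm ((s + 1) * Ln q) + norm L"
        by norm
      also have "\<dots> \<le> 1 + norm (s + 1) * 1 + norm L"
        unfolding norm_mult \<eta>\<eta> using nd nlnq q13 by (intro add_mono mult_left_mono) auto
      finally have w: "norm (exp (\<eta> * x) * cpow x (s - 1)) \<le> exp (1 + norm (s + 1) + norm L) / norm x ^ 2"
        by (simp add: divide_right_mono)
      have "real m * 1 \<le> norm x * norm x"
        using nx elim by (intro mult_mono) auto
      then have "exp (1 + norm (s + 1) + norm L) / norm x ^ 2 \<le> D / real m"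
        using elim x0 C by (intro frac_le) (auto simp: D_def power2_eq_square le_max_iff_disj)
      with w have "norm (exp (\<eta> * x) * cpow x (s - 1)) \<le> D / real m"
        by linarith
      moreover have "norm (clog x - Ln z) \<le> D * t"
      proof -
        have "norm (clog x - Ln z) \<le> 2 * C * t"
          unfolding lnq using nlnq q by linarith
        also have "\<dots> \<le> D * t"
          using t0 by (intro mult_right_mono) (auto simp: D_def)
        finally show ?thesis .
      qed
      ultimately show "norm (clog x - Ln (2 * of_nat m * of_real pi * \<i>)) \<le> D * (ln (real m) / real m)
          \<and> real m \<le> norm x \<and> x \<in> sector \<alpha> \<beta> R \<and> isCont clog x
          \<and> norm (exp (\<eta> * x) * cpow x (s - 1)) \<le> D / real m"
        using nx sec cont by (simp add: z_def t_def)
    qed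
  qed
  moreover have "D > 0"
    using C by (simp add: D_def)
  ultimately show ?thesis
    by blast
qed

section \<open>Solution of the logarithmic equation by a fixed point\<close>

text \<open>Solved for its leading term, the equation says that \<open>x\<close> is a fixed point of
  a map sending the unit disc close to its centre. Brouwer's theorem asks for continuity and size
  only, so \<open>E\<close> enters through these two properties and no Lipschitz estimate is
  made.\<close>

lemma log_equation_solution:
  assumes \<eta>: "\<eta> = 1 \<or> \<eta> = - 1" and A: "A \<ge> 0"
    and E: "\<forall>\<^sub>F m in sequentially. continuous_on (cball (log_center \<eta> s L m) 1) E
              \<and> (\<forall>x\<in>cball (log_center \<eta> s L m) 1. norm (E x) \<le> A / real m)"
  obtains X where
    "(\<lambda>m. X m - log_center \<eta> s L m) \<in> O(\<lambda>m. of_real (ln (real m) / real m))"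
    "\<forall>\<^sub>F m in sequentially. X m \<in> ball (log_center \<eta> s L m) 1
       \<and> \<eta> * X m + (s + 1) * clog (X m) + L + E (X m) = \<eta> * (2 * of_nat m * of_real pi * \<i>)"
proof -
  let ?z = "\<lambda>m. 2 * of_nat m * of_real pi * \<i> :: complex"
  let ?S = "\<lambda>m. cball (log_center \<eta> s L m) 1"
  obtain C where C: "C > 0" and nbhd: "\<forall>\<^sub>F m in sequentially. \<forall>x\<in>?S m.
     norm (clog x - Ln (?z m)) \<le> C * (ln (real m) / real m) \<and> real m \<le> norm x
     \<and> x \<in> sector (- 1) 1 0 \<and> isCont clog x \<and> norm (exp (\<eta> * x) * cpow x (s - 1)) \<le> C / real m"
    using log_center_nbhd[OF \<eta>, of "- 1" 1 s L 0] by auto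
  \<comment> \<open>The first summand is the cost of freezing the logarithm at 2m\<pi>i, the second
    that of \<open>E\<close>, where 1/m is estimated by (log m)/m.\<close>
  define K where "K = norm (s + 1) * C + A"
  have K: "K \<ge> 0"
    using A C by (simp add: K_def)
  have "(\<lambda>m::nat. K * (ln (real m) / real m)) \<longlonglongrightarrow> 0"
    by real_asymp
  then have "\<forall>\<^sub>F m::nat in sequentially. K * (ln (real m) / real m) < 1"
    by (rule order_tendstoD) simp
  moreover have "\<forall>\<^sub>F m::nat in sequentially. ln (real m) \<ge> 1"
    by real_asymp
  ultimately have "\<forall>\<^sub>F m in sequentially. \<exists>x. norm (x - log_center \<eta> s L m) \<le> K * (ln (real m) / real m)
     \<and> x \<in> ball (log_center \<eta> s L m) 1 \<and> \<eta> * x + (s + 1) * clog x + L + E x = \<eta> * ?z m"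
    using nbhd E
  proof eventually_elim
    case (elim m)
    define T where "T x = ?z m - \<eta> * ((s + 1) * clog x + L + E x)" for x
    have close: "norm (T x - log_center \<eta> s L m) \<le> K * (ln (real m) / real m)" if "x \<in> ?S m" for x
    proof -
      have "T x - log_center \<eta> s L m = - \<eta> * ((s + 1) * (clog x - Ln (?z m)) + E x)"
        by (simp add: T_def log_center_def algebra_simps)
      then have "norm (T x - log_center \<eta> s L m) = norm ((s + 1) * (clog x - Ln (?z m)) + E x)"
        using \<eta> by (auto simp: norm_mult)
      also have "\<dots> \<le> norm (s + 1) * norm (clog x - Ln (?z m)) + norm (E x)"
        by (metis norm_triangle_ineq norm_mult)
      also have "\<dots> \<le> norm (s + 1) * (C * (ln (real m) / real m)) + A * (ln (real m) / real m)"
      proof (intro add_mono mult_left_mono)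
        have "norm (E x) \<le> A / real m"
          using elim that by blast
        also have "\<dots> \<le> A * ln (real m) / real m"
          using elim A mult_left_mono[of 1 "ln (real m)" A] by (intro divide_right_mono) auto
        finally show "norm (E x) \<le> A * (ln (real m) / real m)"
          by simp
      qed (use elim that in auto)
      finally show ?thesis
        unfolding K_def by (simp only: distrib_right mult.assoc)
    qed
    have "continuous_on (?S m) clog"
      using elim by (auto intro: continuous_at_imp_continuous_on)
    then have "continuous_on (?S m) T"
      unfolding T_def using elim by (intro continuous_intros) auto
    moreover have "T \<in> ?S m \<rightarrow> ?S m"
    proof
      fix x assume "x \<in> ?S m"
      then have "norm (T x - log_center \<eta> s L m) \<le> 1"
        using close[of x] elim by linarith
      then show "T x \<in> ?S m"
        by (simp add: dist_norm norm_minus_commute)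
    qed
    ultimately obtain x where x: "x \<in> ?S m" "T x = x"
      by (rule brouwer_ball[OF zero_less_one])
    then have d: "norm (x - log_center \<eta> s L m) \<le> K * (ln (real m) / real m)"
      using close[of x] by simp
    \<comment> \<open>Strictness puts the fixed point into the open disc, so that it has a
      neighbourhood on which the estimates still hold.\<close>
    then have "norm (x - log_center \<eta> s L m) < 1"
      using elim by linarith
    moreover have "\<eta> * x + (s + 1) * clog x + L + E x = \<eta> * ?z m"
    proof -
      have "\<eta> * \<eta> = 1"
        using \<eta> by auto
      have "\<eta> * x = \<eta> * T x"
        using x by simp
      also have "\<dots> = \<eta> * ?z m - (\<eta> * \<eta>) * ((s + 1) * clog x + L + E x)"
        by (simp add: T_def algebra_simps)
      finally show ?thesis
        unfolding \<open>\<eta> * \<eta> = 1\<close> by (simp add: algebra_simps)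
    qed
    ultimately show ?case
      using d by (auto simp: dist_norm norm_minus_commute)
  qed
  then obtain X where X: "\<forall>\<^sub>F m in sequentially.
       norm (X m - log_center \<eta> s L m) \<le> K * (ln (real m) / real m)
     \<and> X m \<in> ball (log_center \<eta> s L m) 1
     \<and> \<eta> * X m + (s + 1) * clog (X m) + L + E (X m) = \<eta> * ?z m"
    unfolding eventually_ex by blast
  show ?thesis
  proof
    show "(\<lambda>m. X m - log_center \<eta> s L m) \<in> O(\<lambda>m. of_real (ln (real m) / real m))"
    \<comment> \<open>The rule wants a positive constant, while \<open>K\<close> may be 0.\<close>
    proof (rule landau_o.bigI[of "K + 1"])
      have "\<forall>\<^sub>F m::nat in sequentially. ln (real m) \<ge> 1"
        by real_asymp
      with X show "\<forall>\<^sub>F m in sequentially. norm (X m - log_center \<eta> s L m)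
                     \<le> (K + 1) * norm (of_real (ln (real m) / real m) :: complex)"
      proof eventually_elim
        case (elim m)
        then have *: "norm (of_real (ln (real m) / real m) :: complex) = ln (real m) / real m"
          unfolding norm_of_real by simp
        have "norm (X m - log_center \<eta> s L m) \<le> K * (ln (real m) / real m)"
          using elim by blast
        also have "\<dots> \<le> (K + 1) * (ln (real m) / real m)"
          using elim by (intro mult_right_mono) auto
        finally show ?case
          unfolding * .
      qed
    qed (use K in simp)
    show "\<forall>\<^sub>F m in sequentially. X m \<in> ball (log_center \<eta> s L m) 1
       \<and> \<eta> * X m + (s + 1) * clog (X m) + L + E (X m) = \<eta> * ?z m"
      using X by eventually_elim blast
  qed
qed

section \<open>Zeros of a function with an exponential expansion\<close>

text \<open>Vanishing of the expansion means that the exponential of the logarithmic equation holds.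
  \<open>L\<close> may be any logarithm of \<open>- c / \<kappa>\<close>, so both parts of the
  theorem can insert their own. The balls of continuity are recorded for the passage from zeros of a
  reciprocal to poles.\<close>

lemma exp_expansion_zeros:
  assumes h: "has_exp_expansion Q B (sector \<alpha> \<beta> R) \<epsilon> \<kappa> \<eta> s h"
    and \<eta>: "\<eta> = 1 \<or> \<eta> = - 1" and c: "c \<in> B" and L: "exp L = - c / \<kappa>"
    and \<alpha>: "\<alpha> < 0" "0 < \<beta>" and \<epsilon>: "\<epsilon> > 0"
  obtains X where
    "(\<lambda>m. X m - log_center \<eta> s L m) \<in> O(\<lambda>m. of_real (ln (real m) / real m))"
    "\<forall>\<^sub>F m in sequentially. h c (X m) = 0 \<and>
       (\<exists>r>0. ball (X m) r \<subseteq> small_exp_domain (sector \<alpha> \<beta> R) \<epsilon> \<eta> s \<and> continuous_on (ball (X m) r) (h c))"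
proof -
  let ?z = "\<lambda>m. 2 * of_nat m * of_real pi * \<i> :: complex"
  let ?S = "\<lambda>m. cball (log_center \<eta> s L m) 1"
  let ?D = "sector \<alpha> \<beta> R"
  let ?SE = "small_exp_domain ?D \<epsilon> \<eta> s"
  define w where "w x = exp (\<eta> * x) * cpow x (s - 1)" for x
  \<comment> \<open>For \<open>\<kappa> = 0\<close> the quotient would be 0 by the convention on
    division, and 0 is not a value of \<open>exp\<close>.\<close>
  have \<kappa>0: "\<kappa> \<noteq> 0"
    using L exp_not_eq_zero[of L] by auto
  obtain g0 g1 a g where g0: "inv_asymp Q B ?D g0" and g1: "inv_asymp Q B ?D g1"
    and g: "\<And>n. n \<ge> 1 \<Longrightarrow> inv_asymp Q B ?D (g n)"
    and uc: "\<And>r. r < \<epsilon> \<Longrightarrow> uniformly_convergent_on (?D \<times> cball 0 r)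
            (\<lambda>N (x, w). \<Sum>n=1..N. (a n c + g n c x) * w ^ n)"
    and hc: "\<And>x. x \<in> ?SE \<Longrightarrow> h c x = \<kappa> * (1 / x) * (1 + g0 c x)
              + c * (1 + g1 c x) * exp (\<eta> * x) * cpow x s
                * (1 + (\<Sum>n. (a (Suc n) c + g (Suc n) c x) * w x ^ Suc n))"
    using h c unfolding has_exp_expansion_def w_def by blast
  define b where "b n x = a n c + g n c x" for n x
  define P where "P x = (\<Sum>n. b (Suc n) x * w x ^ Suc n)" for x
  \<comment> \<open>Uniform convergence is available only for radii strictly below
    \<open>\<epsilon>\<close>.\<close>
  define r where "r = \<epsilon> / 2"
  have r: "0 < r" "r < \<epsilon>"
    using \<epsilon> by (auto simp: r_def)
  have uc': "uniformly_convergent_on (?D \<times> cball 0 r) (\<lambda>N (x, w). \<Sum>n=1..N. b n x * w ^ n)"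
    using uc[OF r(2)] by (simp add: b_def)
  have "\<exists>M. \<forall>\<^sub>F x in at_infinity. x \<in> ?D \<longrightarrow> norm (b n x) \<le> M" if n: "n \<ge> 1" for n
  proof -
    obtain C where C: "C > 0" "\<forall>\<^sub>F x in at_infinity. x \<in> ?D \<longrightarrow> norm (g n c x) \<le> C / norm x"
      using inv_asymp_bound[OF g[OF n] c] by blast
    have "\<forall>\<^sub>F x::complex in at_infinity. norm x \<ge> 1"
      unfolding eventually_at_infinity by blast
    with C(2) have "\<forall>\<^sub>F x in at_infinity. x \<in> ?D \<longrightarrow> norm (b n x) \<le> norm (a n c) + C"
    proof eventually_elim
      case (elim x)
      have "norm (b n x) \<le> norm (a n c) + norm (g n c x)"
        unfolding b_def by (rule norm_triangle_ineq)
      moreover have "C / norm x \<le> C / 1"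
        using C elim by (intro divide_left_mono) auto
      ultimately show ?case
        using elim by auto
    qed
    then show ?thesis by blast
  qed
  then obtain M where M: "M > 0" "\<forall>\<^sub>F x in at_infinity. x \<in> ?D \<longrightarrow>
           (\<forall>w. norm w \<le> r / 2 \<longrightarrow> norm (\<Sum>n. b (Suc n) x * w ^ Suc n) \<le> M * norm w)"
    using power_series_uniform_bound[OF uc' r(1)] by blast
  obtain C0 where C0: "C0 > 0" "\<forall>\<^sub>F x in at_infinity. x \<in> ?D \<longrightarrow> norm (g0 c x) \<le> C0 / norm x"
    using inv_asymp_bound[OF g0 c] by blast
  obtain C1 where C1: "C1 > 0" "\<forall>\<^sub>F x in at_infinity. x \<in> ?D \<longrightarrow> norm (g1 c x) \<le> C1 / norm x"
    using inv_asymp_bound[OF g1 c] by blast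
  have "\<forall>\<^sub>F x in at_infinity. x \<in> ?D \<longrightarrow>
           norm (g0 c x) \<le> C0 / norm x \<and> norm (g1 c x) \<le> C1 / norm x \<and>
           (norm (w x) \<le> r / 2 \<longrightarrow> norm (P x) \<le> M * norm (w x))"
    using C0(2) C1(2) M(2) by eventually_elim (simp add: P_def)
  \<comment> \<open>The estimates near infinity are gathered into one radius; they reach the discs
    through \<open>real m \<le> norm x\<close>.\<close>
  then obtain \<rho> where \<rho>: "\<And>x. norm x \<ge> \<rho> \<Longrightarrow> x \<in> ?D \<Longrightarrow>
           norm (g0 c x) \<le> C0 / norm x \<and> norm (g1 c x) \<le> C1 / norm x \<and>
           (norm (w x) \<le> r / 2 \<longrightarrow> norm (P x) \<le> M * norm (w x))"
    unfolding eventually_at_infinity by blast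
  obtain C where C: "C > 0" and nbhd: "\<forall>\<^sub>F m in sequentially. \<forall>x\<in>?S m.
     norm (clog x - Ln (?z m)) \<le> C * (ln (real m) / real m) \<and> real m \<le> norm x
     \<and> x \<in> ?D \<and> isCont clog x \<and> norm (exp (\<eta> * x) * cpow x (s - 1)) \<le> C / real m"
    using log_center_nbhd[OF \<eta> \<alpha>, of s L R] by blast
  define A where "A = Max {C0, C1, M * C}"
  have A: "C0 \<le> A" "C1 \<le> A" "M * C \<le> A"
    by (auto simp: A_def)
  have "(\<lambda>m::nat. A / real m) \<longlonglongrightarrow> 0" "(\<lambda>m::nat. C / real m) \<longlonglongrightarrow> 0"
    by real_asymp+
  \<comment> \<open>The first inequality keeps 1 + \<open>g0\<close>, 1 + \<open>g1\<close> and 1 +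
    \<open>P\<close> off the cut of \<open>Ln\<close>; the second brings \<open>w\<close> into the
    disc where the bound on \<open>P\<close> is valid.\<close>
  then have "\<forall>\<^sub>F m::nat in sequentially. A / real m < 1 / 2" "\<forall>\<^sub>F m::nat in sequentially. C / real m < r / 2"
    using r by (auto intro: order_tendstoD(2) simp del: less_divide_eq_numeral1)
  moreover have "\<forall>\<^sub>F m::nat in sequentially. real m \<ge> max 1 \<rho>"
    by real_asymp
  ultimately have loc: "\<forall>\<^sub>F m in sequentially. ?S m \<subseteq> ?SE \<and> continuous_on (?S m) clog
      \<and> (\<forall>x\<in>?S m. x \<noteq> 0 \<and> norm (w x) < r \<and> norm (g0 c x) \<le> A / real m \<and> norm (g1 c x) \<le> A / real m
           \<and> norm (P x) \<le> A / real m) \<and> A / real m < 1 / 2"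
    using nbhd
  proof eventually_elim
    case (elim m)
    have "x \<in> ?SE \<and> x \<noteq> 0 \<and> norm (w x) < r \<and> norm (g0 c x) \<le> A / real m \<and> norm (g1 c x) \<le> A / real m
           \<and> norm (P x) \<le> A / real m" if "x \<in> ?S m" for x
    proof -
      have x: "real m \<le> norm x" "x \<in> ?D" "norm (w x) \<le> C / real m"
        using elim that by (auto simp: w_def)
      have b: "norm (g0 c x) \<le> C0 / norm x" "norm (g1 c x) \<le> C1 / norm x"
        "norm (w x) \<le> r / 2 \<Longrightarrow> norm (P x) \<le> M * norm (w x)"
        using \<rho>[of x] x elim by auto
      have wr: "norm (w x) < r / 2"
        using x elim by linarith
      have "norm (P x) \<le> M * norm (w x)"
        using b(3) wr by simp
      also have "\<dots> \<le> M * (C / real m)"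
        using x(3) M(1) by (intro mult_left_mono) auto
      also have "\<dots> \<le> A / real m"
        using A(3) by (simp add: divide_right_mono)
      finally have "norm (P x) \<le> A / real m" .
      moreover have "C0 / norm x \<le> A / real m" "C1 / norm x \<le> A / real m"
        using A(1,2) C0(1) C1(1) x(1) elim by (intro frac_le; simp)+
      moreover have "norm (w x) < r"
        using wr r by linarith
      moreover from this have "x \<in> ?SE"
        using x(2) r(2) by (simp add: small_exp_domain_def w_def)
      moreover have "x \<noteq> 0"
        using x(1) elim by auto
      ultimately show ?thesis
        using b(1,2) by (intro conjI) linarith+
    qed
    moreover have "continuous_on (?S m) clog"
      using elim by (auto intro: continuous_at_imp_continuous_on)
    ultimately show ?case
      using elim by blast
  qed
  have cont: "continuous_on (?S m) (g0 c)" "continuous_on (?S m) (g1 c)" "continuous_on (?S m) P"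
    if "?S m \<subseteq> ?SE" "continuous_on (?S m) clog" "\<And>x. x \<in> ?S m \<Longrightarrow> norm (w x) < r" for m
  proof -
    have sub: "?S m \<subseteq> ?D"
      using that(1) by (auto simp: small_exp_domain_def)
    have inv: "continuous_on (?S m) (f c)" if "inv_asymp Q B ?D f" for f
    proof -
      have "f c holomorphic_on ?D"
        using that c unfolding inv_asymp_def by (elim conjE bspec)
      then show ?thesis
        by (rule continuous_on_subset[OF holomorphic_on_imp_continuous_on sub])
    qed
    show "continuous_on (?S m) (g0 c)" "continuous_on (?S m) (g1 c)"
      by (rule inv, fact)+
    show "continuous_on (?S m) P"
      unfolding P_def
    proof (rule power_series_composite_continuous[OF uc' sub])
      show "continuous_on (?S m) w"
        unfolding w_def cpow_def by (intro continuous_intros that(2))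
      show "continuous_on (?S m) (b n)" if "n \<ge> 1" for n
        unfolding b_def by (intro continuous_intros inv g that)
      show "norm (w x) \<le> r" if "x \<in> ?S m" for x
        using \<open>\<And>x. x \<in> ?S m \<Longrightarrow> norm (w x) < r\<close>[OF that] by simp
    qed
  qed
  define E where "E x = Ln (1 + g1 c x) + Ln (1 + P x) - Ln (1 + g0 c x)" for x
  have not_neg: "1 + u \<notin> \<real>\<^sub>\<le>\<^sub>0" if "norm u < 1 / 2" for u :: complex
    using that abs_Re_le_cmod[of u] by (auto simp: complex_nonpos_Reals_iff)
  \<comment> \<open>The factor 6 arises from three logarithms, each estimated by
    \<open>norm (Ln (1 + u)) \<le> 2 * norm u\<close>.\<close>
  have "\<forall>\<^sub>F m in sequentially. continuous_on (?S m) E \<and> (\<forall>x\<in>?S m. norm (E x) \<le> (6 * A) / real m)"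
    using loc
  proof eventually_elim
    case (elim m)
    have lt: "norm (g0 c x) < 1 / 2" "norm (g1 c x) < 1 / 2" "norm (P x) < 1 / 2" if "x \<in> ?S m" for x
    proof -
      have "norm (g0 c x) \<le> A / real m" "norm (g1 c x) \<le> A / real m" "norm (P x) \<le> A / real m"
        "A / real m < 1 / 2"
        using elim that by blast+
      then show "norm (g0 c x) < 1 / 2" "norm (g1 c x) < 1 / 2" "norm (P x) < 1 / 2"
        by linarith+
    qed
    have "continuous_on (?S m) E"
      unfolding E_def using elim cont[of m] lt
      by (intro continuous_intros not_neg ballI) auto
    moreover have "norm (E x) \<le> (6 * A) / real m" if "x \<in> ?S m" for x
    proof -
      have "norm (E x) \<le> norm (Ln (1 + g1 c x)) + norm (Ln (1 + P x)) + norm (Ln (1 + g0 c x))"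
        unfolding E_def by norm
      also have "\<dots> \<le> 2 * norm (g1 c x) + 2 * norm (P x) + 2 * norm (g0 c x)"
        using lt[OF that] by (intro add_mono norm_Ln_le) auto
      also have "\<dots> \<le> 2 * (A / real m) + 2 * (A / real m) + 2 * (A / real m)"
        using elim that by (intro add_mono mult_left_mono) auto
      finally show ?thesis by simp
    qed
    ultimately show ?case by blast
  qed
  from log_equation_solution[OF \<eta> _ this] obtain X where O: "(\<lambda>m. X m - log_center \<eta> s L m) \<in> O(\<lambda>m. of_real (ln (real m) / real m))"
    and X: "\<forall>\<^sub>F m in sequentially. X m \<in> ball (log_center \<eta> s L m) 1
       \<and> \<eta> * X m + (s + 1) * clog (X m) + L + E (X m) = \<eta> * ?z m"
    using A(1) C0(1) by auto
  show ?thesis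
  proof
    show "(\<lambda>m. X m - log_center \<eta> s L m) \<in> O(\<lambda>m. of_real (ln (real m) / real m))"
      by fact
    show "\<forall>\<^sub>F m in sequentially. h c (X m) = 0 \<and>
       (\<exists>r>0. ball (X m) r \<subseteq> ?SE \<and> continuous_on (ball (X m) r) (h c))"
      using X loc
    proof eventually_elim
      case (elim m)
      define x where "x = X m"
      have xS: "x \<in> ?S m"
        using elim by (simp add: x_def)
      have x0: "x \<noteq> 0" and xSE: "x \<in> ?SE"
        using elim xS by blast+
      have "norm (g0 c x) \<le> A / real m" "norm (g1 c x) \<le> A / real m" "norm (P x) \<le> A / real m"
        "A / real m < 1 / 2"
        using elim xS by blast+
      then have lt: "norm (g0 c x) < 1 / 2" "norm (g1 c x) < 1 / 2" "norm (P x) < 1 / 2"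
        by linarith+
      have nz: "1 + g0 c x \<noteq> 0" "1 + g1 c x \<noteq> 0" "1 + P x \<noteq> 0"
        using not_neg lt by fastforce+
      have "\<eta> * x + (s * clog x + clog x) + L + (Ln (1 + g1 c x) + Ln (1 + P x) - Ln (1 + g0 c x)) = \<eta> * ?z m"
        using elim by (simp add: x_def E_def algebra_simps)
      then have "exp (\<eta> * x + (s * clog x + clog x) + L + (Ln (1 + g1 c x) + Ln (1 + P x) - Ln (1 + g0 c x))) = 1"
        using exp_imaginary_nat_eq_1[OF \<eta>, of m] by simp
      then have *: "exp (\<eta> * x) * (cpow x s * x) * (- c / \<kappa>) * ((1 + g1 c x) * (1 + P x) / (1 + g0 c x)) = 1"
        using nz x0 L by (simp add: exp_add exp_diff exp_clog cpow_def)
      \<comment> \<open>With these abbreviations the exponentiated equation is linear in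
        \<open>\<kappa> * d\<close>. The product \<open>cpow x s * x\<close> in it comes from the
        coefficient \<open>s + 1\<close> of the logarithm.\<close>
      define d q where "d = 1 + g0 c x" and "q = (1 + g1 c x) * (1 + P x)"
      have \<kappa>d: "\<kappa> * d = - (c * q * (exp (\<eta> * x) * (cpow x s * x)))"
        using * nz(1) \<kappa>0 unfolding d_def[symmetric] q_def[symmetric] by (simp add: field_simps)
      have "\<kappa> * (1 / x) * d + c * q * exp (\<eta> * x) * cpow x s = (\<kappa> * d) / x + c * q * exp (\<eta> * x) * cpow x s"
        by simp
      also have "\<dots> = 0"
        unfolding \<kappa>d using x0 by simp
      finally have "\<kappa> * (1 / x) * d + c * q * exp (\<eta> * x) * cpow x s = 0" .
      then have "\<kappa> * (1 / x) * (1 + g0 c x) + c * (1 + g1 c x) * exp (\<eta> * x) * cpow x s * (1 + P x) = 0"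
        by (simp only: d_def q_def mult_ac)
      then have "h c x = 0"
        using hc[OF xSE] by (simp add: P_def b_def)
      moreover have "continuous_on (?S m) (h c)"
      proof -
        have cont_rhs: "continuous_on (?S m) (\<lambda>x. \<kappa> * (1 / x) * (1 + g0 c x)
            + c * (1 + g1 c x) * exp (\<eta> * x) * cpow x s * (1 + P x))"
          unfolding cpow_def using elim cont[of m] by (intro continuous_intros) auto
        have eq: "h c x = \<kappa> * (1 / x) * (1 + g0 c x)
            + c * (1 + g1 c x) * exp (\<eta> * x) * cpow x s * (1 + P x)" if "x \<in> ?S m" for x
          using hc[of x] elim that by (auto simp: P_def b_def)
        show ?thesis
          by (rule continuous_on_eq[OF cont_rhs eq[symmetric]])
      qed
      moreover obtain t where t: "t > 0" "ball x t \<subseteq> ball (log_center \<eta> s L m) 1"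
        by (rule openE[OF open_ball]) (use elim in \<open>auto simp: x_def\<close>)
      moreover have "ball x t \<subseteq> ?S m"
        using t(2) ball_subset_cball by (rule order_trans)
      moreover have "?S m \<subseteq> ?SE"
        using elim by blast
      ultimately show ?case
        unfolding x_def by (metis continuous_on_subset order_trans)
    qed
  qed
qed

section \<open>From zeros of the reciprocal to poles\<close>

text \<open>Near \<open>z\<close>, but off \<open>z\<close>, the function \<open>y\<close> is the
  inverse of \<open>u\<close>, and \<open>u\<close> tends to 0 there without vanishing.\<close>

lemma is_pole_of_reciprocal_zero:
  assumes sol: "painleve5_solution \<theta>0 \<theta>x \<theta>inf D y"
    and u: "\<And>x. x \<in> D \<Longrightarrow> \<not> is_pole y x \<Longrightarrow> 1 / y x = u x"
    and r: "r > 0" "ball z r \<subseteq> D" "continuous_on (ball z r) u" and "u z = 0"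
  shows "is_pole y z"
proof -
  have z: "z \<in> D"
    using r by auto
  \<comment> \<open>A solution avoids 0 off isolated points, and so \<open>1 / y x\<close> is a
    genuine, nonzero reciprocal in a punctured neighbourhood.\<close>
  have "\<forall>\<^sub>F x in at z. y x \<noteq> 0 \<and> y x \<noteq> 1 \<and> painleve5_at \<theta>0 \<theta>x \<theta>inf y x"
    using sol z unfolding painleve5_solution_def by (blast intro: eventually_cosparse_imp_eventually_at)
  \<comment> \<open>The relation between \<open>u\<close> and \<open>y\<close> is given only where
    \<open>y\<close> has no pole; poles of a meromorphic function are isolated.\<close>
  moreover have "\<forall>\<^sub>F x in at z. \<not> is_pole y x"
    using sol z unfolding painleve5_solution_def
    by (blast intro: eventually_cosparse_imp_eventually_at meromorphic_on_imp_not_pole_cosparse)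
  moreover have "\<forall>\<^sub>F x in at z. x \<in> ball z r"
    using r by (intro eventually_at_in_open') auto
  ultimately have ev: "\<forall>\<^sub>F x in at z. u x \<noteq> 0 \<and> inverse (u x) = y x"
  proof eventually_elim
    case (elim x)
    then have "u x = 1 / y x"
      using u[of x] r by auto
    then show ?case
      using elim by simp
  qed
  have "isCont u z"
    using r by (simp add: continuous_on_eq_continuous_at)
  then have "u \<midarrow>z\<rightarrow> 0"
    using \<open>u z = 0\<close> by (simp add: isCont_def)
  then have "filterlim u (at 0) (at z)"
    by (rule filterlim_atI) (use ev in eventually_elim, simp)
  then have "filterlim (\<lambda>x. inverse (u x)) at_infinity (at z)"
    by (rule filterlim_compose[OF filterlim_inverse_at_infinity])
  then show ?thesis
    unfolding is_pole_def by (rule filterlim_mono_eventually) (use ev in \<open>auto elim: eventually_mono\<close>)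
qed

section \<open>The two families\<close>

theorem theorem2p27:
  fixes \<theta>0 \<theta>x \<theta>inf \<sigma>0 \<sigma>0' :: complex and \<delta> :: real and B :: "complex set"
  assumes "0 < \<delta>" and "\<delta> < pi / 2"
    and "open B" and "connected B" and "bounded B" and "0 \<in> B"
    and "\<sigma>0 = - 2 * \<theta>x - \<theta>inf"
    and "\<sigma>0' = 2 * \<theta>0 + \<theta>inf"
  shows "(\<forall>\<epsilon> R y. \<theta>x * (\<theta>0 - \<theta>x - \<theta>inf) \<noteq> 0 \<and>
            y_plus_family \<theta>0 \<theta>x \<theta>inf \<sigma>0 \<delta> B \<epsilon> R y \<longrightarrow>
            (\<exists>\<rho>>0. \<forall>c. c \<noteq> 0 \<and> cmod c < \<rho> \<longrightarrow>
               c \<in> B \<and>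
               (\<exists>(m0::nat) (X :: nat \<Rightarrow> complex).
                  m0 > 0 \<and>
                  (\<forall>m\<ge>m0. X m \<in> dom_plus \<delta> \<epsilon> R \<sigma>0 \<and> y c (X m) = 0) \<and>
                  (\<lambda>m. X m - (2 * of_nat m * of_real pi * \<i>
                               - (\<sigma>0 + 1) * Ln (2 * of_nat m * of_real pi * \<i>)
                               - Ln (- 2 * c / (\<theta>0 - \<theta>x - \<theta>inf))))
                    \<in> O(\<lambda>m. of_real (ln (real m) / real m)))))
       \<and> (\<forall>\<epsilon> R y. \<theta>0 * (\<theta>x - \<theta>0 - \<theta>inf) \<noteq> 0 \<and>
            y_minus_family \<theta>0 \<theta>x \<theta>inf \<sigma>0' \<delta> B \<epsilon> R y \<longrightarrow>
            (\<exists>\<rho>>0. \<forall>c'. c' \<noteq> 0 \<and> cmod c' < \<rho> \<longrightarrow>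
               c' \<in> B \<and>
               (\<exists>(m0::nat) (X :: nat \<Rightarrow> complex).
                  m0 > 0 \<and>
                  (\<forall>m\<ge>m0. X m \<in> dom_minus \<delta> \<epsilon> R \<sigma>0' \<and> is_pole (y c') (X m)) \<and>
                  (\<lambda>m. X m - (2 * of_nat m * of_real pi * \<i>
                               - (\<sigma>0' - 1) * Ln (2 * of_nat m * of_real pi * \<i>)
                               + Ln (2 * c' / (\<theta>x - \<theta>0 - \<theta>inf))))
                    \<in> O(\<lambda>m. of_real (ln (real m) / real m)))))"
proof (intro conjI allI impI)
  \<comment> \<open>Smallness of the parameter means membership in a disc about 0 inside
    \<open>B\<close>.\<close>
  obtain \<rho> where \<rho>: "\<rho> > 0" "ball 0 \<rho> \<subseteq> B"
    using \<open>open B\<close> \<open>0 \<in> B\<close> open_contains_ball by blast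
  have small_in_B: "c \<in> B" if "norm c < \<rho>" for c
    using that \<rho> by auto
  fix \<epsilon> R y
  {
    assume "\<theta>x * (\<theta>0 - \<theta>x - \<theta>inf) \<noteq> 0 \<and> y_plus_family \<theta>0 \<theta>x \<theta>inf \<sigma>0 \<delta> B \<epsilon> R y"
    then have nz: "\<theta>0 - \<theta>x - \<theta>inf \<noteq> 0" and fam: "y_plus_family \<theta>0 \<theta>x \<theta>inf \<sigma>0 \<delta> B \<epsilon> R y"
      by auto
    then have exp_y: "has_exp_expansion (Q1 \<theta>0 \<theta>x \<theta>inf) B (sector_plus \<delta> R) \<epsilon>
            ((\<theta>0 - \<theta>x - \<theta>inf) / 2) 1 \<sigma>0 y"
      unfolding y_plus_family_def by blast
    have "c \<in> B \<and>
               (\<exists>(m0::nat) (X :: nat \<Rightarrow> complex).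
                  m0 > 0 \<and>
                  (\<forall>m\<ge>m0. X m \<in> dom_plus \<delta> \<epsilon> R \<sigma>0 \<and> y c (X m) = 0) \<and>
                  (\<lambda>m. X m - (2 * of_nat m * of_real pi * \<i>
                               - (\<sigma>0 + 1) * Ln (2 * of_nat m * of_real pi * \<i>)
                               - Ln (- 2 * c / (\<theta>0 - \<theta>x - \<theta>inf))))
                    \<in> O(\<lambda>m. of_real (ln (real m) / real m)))"
      if c: "c \<noteq> 0 \<and> norm c < \<rho>" for c
    proof -
      have cB: "c \<in> B"
        using c small_in_B by blast
      define L where "L = Ln (- 2 * c / (\<theta>0 - \<theta>x - \<theta>inf))"
      have L: "exp L = - c / ((\<theta>0 - \<theta>x - \<theta>inf) / 2)"
        unfolding L_def using c nz by (subst exp_Ln) auto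
      obtain X where O: "(\<lambda>m. X m - log_center 1 \<sigma>0 L m) \<in> O(\<lambda>m. of_real (ln (real m) / real m))"
        and X: "\<forall>\<^sub>F m in sequentially. y c (X m) = 0 \<and> (\<exists>r>0.
            ball (X m) r \<subseteq> small_exp_domain (sector_plus \<delta> R) \<epsilon> 1 \<sigma>0 \<and> continuous_on (ball (X m) r) (y c))"
        \<comment> \<open>The bounds on \<open>\<delta>\<close> put the direction of the positive
          imaginary axis inside the sector.\<close>
        by (rule exp_expansion_zeros[OF exp_y _ cB L])
          (use fam \<open>0 < \<delta>\<close> \<open>\<delta> < pi / 2\<close> in \<open>auto simp: y_plus_family_def\<close>)
      have "\<forall>\<^sub>F m in sequentially. X m \<in> dom_plus \<delta> \<epsilon> R \<sigma>0 \<and> y c (X m) = 0"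
        using X by eventually_elim (force simp: dom_plus_def)
      then obtain m0 where "\<And>m. m \<ge> m0 \<Longrightarrow> X m \<in> dom_plus \<delta> \<epsilon> R \<sigma>0 \<and> y c (X m) = 0"
        unfolding eventually_sequentially by blast
      then show ?thesis
        \<comment> \<open>The successor makes the starting index positive.\<close>
        using cB O by (intro conjI exI[of _ "Suc m0"] exI[of _ X])
          (auto simp: log_center_def L_def diff_diff_eq)
    qed
    then show "\<exists>\<rho>>0. \<forall>c. c \<noteq> 0 \<and> cmod c < \<rho> \<longrightarrow>
               c \<in> B \<and>
               (\<exists>(m0::nat) (X :: nat \<Rightarrow> complex).
                  m0 > 0 \<and>
                  (\<forall>m\<ge>m0. X m \<in> dom_plus \<delta> \<epsilon> R \<sigma>0 \<and> y c (X m) = 0) \<and>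
                  (\<lambda>m. X m - (2 * of_nat m * of_real pi * \<i>
                               - (\<sigma>0 + 1) * Ln (2 * of_nat m * of_real pi * \<i>)
                               - Ln (- 2 * c / (\<theta>0 - \<theta>x - \<theta>inf))))
                    \<in> O(\<lambda>m. of_real (ln (real m) / real m)))"
      using \<rho>(1) by blast
  }
  {
    assume "\<theta>0 * (\<theta>x - \<theta>0 - \<theta>inf) \<noteq> 0 \<and> y_minus_family \<theta>0 \<theta>x \<theta>inf \<sigma>0' \<delta> B \<epsilon> R y"
    then have nz: "\<theta>x - \<theta>0 - \<theta>inf \<noteq> 0" and fam: "y_minus_family \<theta>0 \<theta>x \<theta>inf \<sigma>0' \<delta> B \<epsilon> R y"
      by auto
    obtain u where exp_u: "has_exp_expansion (Q2 \<theta>0 \<theta>x \<theta>inf) B (sector_minus \<delta> R) \<epsilon>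
            ((\<theta>0 - \<theta>x + \<theta>inf) / 2) (-1) (- \<sigma>0') u"
      and u: "\<And>c x. c \<in> B \<Longrightarrow> x \<in> dom_minus \<delta> \<epsilon> R \<sigma>0' \<Longrightarrow> \<not> is_pole (y c) x \<Longrightarrow> 1 / y c x = u c x"
      using fam unfolding y_minus_family_def by blast
    have "c \<in> B \<and>
               (\<exists>(m0::nat) (X :: nat \<Rightarrow> complex).
                  m0 > 0 \<and>
                  (\<forall>m\<ge>m0. X m \<in> dom_minus \<delta> \<epsilon> R \<sigma>0' \<and> is_pole (y c) (X m)) \<and>
                  (\<lambda>m. X m - (2 * of_nat m * of_real pi * \<i>
                               - (\<sigma>0' - 1) * Ln (2 * of_nat m * of_real pi * \<i>)
                               + Ln (2 * c / (\<theta>x - \<theta>0 - \<theta>inf))))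
                    \<in> O(\<lambda>m. of_real (ln (real m) / real m)))"
      if c: "c \<noteq> 0 \<and> norm c < \<rho>" for c
    proof -
      have cB: "c \<in> B"
        using c small_in_B by blast
      define L where "L = Ln (2 * c / (\<theta>x - \<theta>0 - \<theta>inf))"
      \<comment> \<open>Here \<open>\<kappa>\<close> is minus half of
        \<open>\<theta>x - \<theta>0 - \<theta>inf\<close>, which absorbs the sign of
        \<open>- c / \<kappa>\<close>.\<close>
      have "- c / ((\<theta>0 - \<theta>x + \<theta>inf) / 2) = - c / (- (\<theta>x - \<theta>0 - \<theta>inf) / 2)"
        by simp
      also have "\<dots> = 2 * c / (\<theta>x - \<theta>0 - \<theta>inf)"
        unfolding minus_divide_left[symmetric] minus_divide_divide by (simp add: mult.commute)
      finally have L: "exp L = - c / ((\<theta>0 - \<theta>x + \<theta>inf) / 2)"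
        unfolding L_def using c nz by (subst exp_Ln) auto
      obtain X where O: "(\<lambda>m. X m - log_center (-1) (- \<sigma>0') L m) \<in> O(\<lambda>m. of_real (ln (real m) / real m))"
        and X: "\<forall>\<^sub>F m in sequentially. u c (X m) = 0 \<and> (\<exists>r>0.
            ball (X m) r \<subseteq> small_exp_domain (sector_minus \<delta> R) \<epsilon> (-1) (- \<sigma>0') \<and> continuous_on (ball (X m) r) (u c))"
        by (rule exp_expansion_zeros[OF exp_u _ cB L])
          (use fam \<open>0 < \<delta>\<close> \<open>\<delta> < pi / 2\<close> in \<open>auto simp: y_minus_family_def\<close>)
      have sol: "painleve5_solution \<theta>0 \<theta>x \<theta>inf (dom_minus \<delta> \<epsilon> R \<sigma>0') (y c)"
        using fam cB unfolding y_minus_family_def by blast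
      have "\<forall>\<^sub>F m in sequentially. X m \<in> dom_minus \<delta> \<epsilon> R \<sigma>0' \<and> is_pole (y c) (X m)"
        using X
      proof eventually_elim
        case (elim m)
        then obtain r where r: "r > 0" "ball (X m) r \<subseteq> dom_minus \<delta> \<epsilon> R \<sigma>0'"
          "continuous_on (ball (X m) r) (u c)" "u c (X m) = 0"
          unfolding dom_minus_def by blast
        have "is_pole (y c) (X m)"
          by (rule is_pole_of_reciprocal_zero[OF sol u[OF cB] r])
        then show ?case
          using r by force
      qed
      then obtain m0 where "\<And>m. m \<ge> m0 \<Longrightarrow> X m \<in> dom_minus \<delta> \<epsilon> R \<sigma>0' \<and> is_pole (y c) (X m)"
        unfolding eventually_sequentially by blast
      \<comment> \<open>With \<open>\<eta>\<close> = -1 the correction enters with a plus sign: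
        \<open>s + 1\<close> becomes \<open>1 - \<sigma>0'\<close>, and \<open>L\<close> is added,
        in contrast to the first family.\<close>
      moreover have "log_center (-1) (- \<sigma>0') L m = 2 * of_nat m * of_real pi * \<i>
                               - (\<sigma>0' - 1) * Ln (2 * of_nat m * of_real pi * \<i>) + L" for m
        by (simp add: log_center_def algebra_simps)
      ultimately show ?thesis
        using cB O by (intro conjI exI[of _ "Suc m0"] exI[of _ X]) (auto simp: L_def)
    qed
    then show "\<exists>\<rho>>0. \<forall>c'. c' \<noteq> 0 \<and> cmod c' < \<rho> \<longrightarrow>
               c' \<in> B \<and>
               (\<exists>(m0::nat) (X :: nat \<Rightarrow> complex).
                  m0 > 0 \<and>
                  (\<forall>m\<ge>m0. X m \<in> dom_minus \<delta> \<epsilon> R \<sigma>0' \<and> is_pole (y c') (X m)) \<and>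
                  (\<lambda>m. X m - (2 * of_nat m * of_real pi * \<i>
                               - (\<sigma>0' - 1) * Ln (2 * of_nat m * of_real pi * \<i>)
                               + Ln (2 * c' / (\<theta>x - \<theta>0 - \<theta>inf))))
                    \<in> O(\<lambda>m. of_real (ln (real m) / real m)))"
      using \<rho>(1) by blast
  }
qed

end
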